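(* For the problem $y'(t)+My(t)=f(y(t))$, $y(t_0)=y_0$, with sufficiently smooth $f$, consider the one-stage SVERK method (with $b_1=1$, $c_1=1$, $a_{11}=1/2$, $w_s(z)=0$) $$Y_1=e^{-hM}y_n+\frac h2 f(Y_1),\qquad y_{n+1}=e^{-hM}y_n+hf(Y_1).$$ This method is of order one, and it is symplectic when applied to Hamiltonian systems, i.e. when $M=-J^{-1}Q$ with $Q$ a real symmetric matrix, $f(y)=J^{-1}\nabla U(y)$ with $U$ a smooth real-valued function, and $J=\begin{pmatrix}0&I\\-I&0\end{pmatrix}$.
   Context: Here $M$ is a constant $m\times m$ matrix. The stage $Y_1$ is the solution of the implicit equation (for small $h$, the one near $y_n$), depending smoothly on $y_n$. Order: a one-step method is of order $p$ if, for $y_0=y(t_0)$, the Taylor expansions in $h$ of the numerical solution $y_1$ after one step and of the exact solution $y(t_0+h)$ coincide up to and including the $h^p$ term. Symplecticity: a method is symplectic if $\big(\frac{\partial y_{n+1}}{\partial y_0}\big)^{\intercal}J\big(\frac{\partial y_{n+1}}{\partial y_0}\big)=\big(\frac{\partial y_n}{\partial y_0}\big)^{\intercal}J\big(\frac{\partial y_n}{\partial y_0}\big)$. *)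

theory Defs
  imports "HOL-Analysis.Analysis"
begin

text \<open>The library has no exponential on \<open>real^'n^'n\<close>: the multiplication \<open>*\<close> of that type is
  componentwise, so its power series is written out with the matrix product \<open>**\<close>.\<close>

definition mat_exp :: "real^'n^'n \<Rightarrow> real^'n^'n" where
  "mat_exp A = (\<Sum>k. (1 / fact k) *\<^sub>R (((**) A ^^ k) (mat 1)))"

text \<open>\<open>C\<^sup>k\<close> on the whole (finite-dimensional) space, through directional derivatives.\<close>

primrec Ck :: "nat \<Rightarrow> ('a::euclidean_space \<Rightarrow> 'b::euclidean_space) \<Rightarrow> bool" where
  "Ck 0 f \<longleftrightarrow> continuous_on UNIV f"
| "Ck (Suc k) f \<longleftrightarrow>
     (\<forall>x. f differentiable (at x)) \<and> (\<forall>v. Ck k (\<lambda>x. frechet_derivative f (at x) v))"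


definition solves_ivp ::
  "real^'n^'n \<Rightarrow> (real^'n \<Rightarrow> real^'n) \<Rightarrow> real \<Rightarrow> real^'n \<Rightarrow> (real \<Rightarrow> real^'n) \<Rightarrow> bool" where
  "solves_ivp M f t0 y0 y \<longleftrightarrow>
     y t0 = y0 \<and>
     (\<forall>\<^sub>F t in nhds t0. \<exists>y'. (y has_vector_derivative y') (at t) \<and> y' + M *v y t = f (y t))"

text \<open>\<open>c 0, \<dots>, c p\<close> are the Taylor coefficients of \<open>g\<close> at \<open>0\<close>: \<open>D j\<close> is the \<open>j\<close>-th derivative of
  \<open>g\<close> near \<open>0\<close>, except that the derivative of top order \<open>p\<close> is only needed at \<open>0\<close> itself.\<close>

definition has_taylor_coeffs ::
  "nat \<Rightarrow> (real \<Rightarrow> 'a::real_normed_vector) \<Rightarrow> (nat \<Rightarrow> 'a) \<Rightarrow> bool" where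
  "has_taylor_coeffs p g c \<longleftrightarrow>
     (\<exists>D. D 0 = g \<and>
        (\<forall>j<p. (D j has_vector_derivative D (Suc j) 0) (at 0)) \<and>
        (\<forall>j. Suc j < p \<longrightarrow>
           (\<forall>\<^sub>F h in nhds 0. (D j has_vector_derivative D (Suc j) h) (at h))) \<and>
        (\<forall>j\<le>p. c j = (1 / fact j) *\<^sub>R D j 0))"

text \<open>A one-step method is given by its step map \<open>\<Phi>\<close>, with \<open>y\<^sub>n\<^sub>+\<^sub>1 = \<Phi> h y\<^sub>n\<close>.\<close>

definition has_order ::
  "nat \<Rightarrow> real^'n^'n \<Rightarrow> (real^'n \<Rightarrow> real^'n) \<Rightarrow> (real \<Rightarrow> real^'n \<Rightarrow> real^'n) \<Rightarrow> bool" where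
  "has_order p M f \<Phi> \<longleftrightarrow>
     (\<forall>t0 y0 y. solves_ivp M f t0 y0 y \<longrightarrow>
        (\<exists>c. has_taylor_coeffs p (\<lambda>h. \<Phi> h y0) c \<and> has_taylor_coeffs p (\<lambda>h. y (t0 + h)) c))"

text \<open>\<open>\<Psi> h y\<^sub>n\<close> is the stage \<open>Y\<^sub>1\<close>. The open neighbourhood \<open>G\<close> of \<open>{0} \<times> \<real>\<^sup>m\<close> makes ``small \<open>h\<close>''
  precise (the admissible step sizes depend on \<open>y\<^sub>n\<close>). Since the equation forces \<open>\<Psi> 0 y = y\<close>,
  continuity on \<open>G\<close> selects the solution near \<open>y\<^sub>n\<close>. Of the smooth dependence on \<open>y\<^sub>n\<close>, only
  differentiability is required.\<close>

definition sverk_stage ::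
  "real^'n^'n \<Rightarrow> (real^'n \<Rightarrow> real^'n) \<Rightarrow> (real \<times> (real^'n)) set
     \<Rightarrow> (real \<Rightarrow> real^'n \<Rightarrow> real^'n) \<Rightarrow> bool" where
  "sverk_stage M f G \<Psi> \<longleftrightarrow>
     open G \<and> (\<forall>y. (0, y) \<in> G) \<and>
     continuous_on G (\<lambda>(h, y). \<Psi> h y) \<and>
     (\<forall>h y. (h, y) \<in> G \<longrightarrow>
        \<Psi> h y = mat_exp (- (h *\<^sub>R M)) *v y + (h / 2) *\<^sub>R f (\<Psi> h y) \<and>
        \<Psi> h differentiable (at y))"

definition sverk_step ::
  "real^'n^'n \<Rightarrow> (real^'n \<Rightarrow> real^'n) \<Rightarrow> (real \<Rightarrow> real^'n \<Rightarrow> real^'n)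
     \<Rightarrow> real \<Rightarrow> real^'n \<Rightarrow> real^'n" where
  "sverk_step M f \<Psi> h y = mat_exp (- (h *\<^sub>R M)) *v y + h *\<^sub>R f (\<Psi> h y)"

text \<open>The numerical solution is \<open>y\<^sub>n = (\<Phi> h ^^ n) y\<^sub>0\<close>; the identity is required as long as the steps
  taken stay inside the domain \<open>G\<close> of the method.\<close>

definition symplectic_method ::
  "real^'n^'n \<Rightarrow> (real \<times> (real^'n)) set \<Rightarrow> (real \<Rightarrow> real^'n \<Rightarrow> real^'n) \<Rightarrow> bool" where
  "symplectic_method J G \<Phi> \<longleftrightarrow>
     (\<forall>h y0 n. (\<forall>k\<le>n. (h, (\<Phi> h ^^ k) y0) \<in> G) \<longrightarrow>
        (\<Phi> h ^^ n) differentiable (at y0) \<and>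
        (\<Phi> h ^^ Suc n) differentiable (at y0) \<and>
        transpose (jacobian (\<Phi> h ^^ Suc n) (at y0)) ** J ** jacobian (\<Phi> h ^^ Suc n) (at y0) =
        transpose (jacobian (\<Phi> h ^^ n) (at y0)) ** J ** jacobian (\<Phi> h ^^ n) (at y0))"

text \<open>\<open>J = (0, I; -I, 0)\<close>: the two halves of the index set are the summands of \<open>'d + 'd\<close>.\<close>

definition Jmat :: "real^('d::finite + 'd)^('d + 'd)" where
  "Jmat = (\<chi> i j. case (i, j) of
       (Inl a, Inr b) \<Rightarrow> if a = b then 1 else 0
     | (Inr a, Inl b) \<Rightarrow> if a = b then - 1 else 0
     | _ \<Rightarrow> 0)"

end

theory Submission
  imports Defs
begin

text \<open>The matrix \<open>X t = mat_exp (t A)\<close> solves \<open>X' = A X\<close>. At \<open>t = 0\<close> this yields order one; when \<open>A\<close>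
  is a Hamiltonian matrix it yields \<open>X\<^sup>T J X = J\<close>. If \<open>P\<close> is the Jacobian of the stage, \<open>F\<close> that of \<open>f\<close>
  at the stage and \<open>B = (h/2) F P\<close>, then the exponential is \<open>P - B\<close> and the Jacobian of the step is
  \<open>P + B\<close>. The forms \<open>(P \<plusminus> B)\<^sup>T J (P \<plusminus> B)\<close> coincide because their cross terms sum to
  \<open>(h/2) P\<^sup>T (F\<^sup>T J + J F) P\<close>, and \<open>F = J\<^sup>-\<^sup>1 H\<close> with the Hessian \<open>H\<close> of \<open>U\<close> symmetric.\<close>

section \<open>Matrix products as bounded bilinear maps\<close>

lemma bounded_bilinear_matrix_matrix_mult:
  "bounded_bilinear ((**) :: real^'n^'m \<Rightarrow> real^'p^'n \<Rightarrow> real^'p^'m)"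
  unfolding bilinear_conv_bounded_bilinear [symmetric] bilinear_def
  by (auto intro!: linearI
      simp: matrix_matrix_mult_def vec_eq_iff algebra_simps sum.distrib sum_distrib_left)

lemma bounded_bilinear_matrix_vector_mult:
  "bounded_bilinear ((*v) :: real^'n^'m \<Rightarrow> real^'n \<Rightarrow> real^'m)"
  unfolding bilinear_conv_bounded_bilinear [symmetric] bilinear_def
  by (auto intro!: linearI
      simp: matrix_vector_mult_def vec_eq_iff algebra_simps sum.distrib sum_distrib_left)

interpretation mm: bounded_bilinear "(**) :: real^'n^'m \<Rightarrow> real^'p^'n \<Rightarrow> real^'p^'m"
  by (rule bounded_bilinear_matrix_matrix_mult)

interpretation mv: bounded_bilinear "(*v) :: real^'n^'m \<Rightarrow> real^'n \<Rightarrow> real^'m"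
  by (rule bounded_bilinear_matrix_vector_mult)

lemma transpose_add: "transpose (A + B) = transpose A + transpose (B :: real^'n^'m)"
  by (simp add: transpose_def vec_eq_iff)

lemma transpose_diff: "transpose (A - B) = transpose A - transpose (B :: real^'n^'m)"
  by (simp add: transpose_def vec_eq_iff)

lemma transpose_minus: "transpose (- A) = - transpose (A :: real^'n^'m)"
  by (simp add: transpose_def vec_eq_iff)

section \<open>The matrix exponential and its derivative\<close>

text \<open>The product is bounded by the product of the norms only up to a factor \<open>K\<close>,
  so the \<open>k\<close>-th power of \<open>A\<close> grows at most like
  \<open>(norm A * K) ^ k\<close>. The real exponential series at
  \<open>\<bar>t\<bar> * (norm A * K)\<close> is then a majorant.\<close>

lemma summable_mat_exp:
  fixes A :: "real^'n^'n"
  shows "summable (\<lambda>k. (t ^ k / fact k) *\<^sub>R (((**) A ^^ k) (mat 1)))"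
proof -
  obtain K where K: "K > 0" "\<And>(X::real^'n^'n) (Y::real^'n^'n). norm (X ** Y) \<le> norm X * norm Y * K"
    using mm.pos_bounded by blast
  have pow: "norm (((**) A ^^ k) (mat 1)) \<le> norm (mat 1 :: real^'n^'n) * (norm A * K) ^ k" for k
  proof (induction k)
    case (Suc k)
    have "norm (((**) A ^^ Suc k) (mat 1)) \<le> norm A * norm (((**) A ^^ k) (mat 1)) * K"
      using K(2) by simp
    also have "\<dots> \<le> norm A * (norm (mat 1 :: real^'n^'n) * (norm A * K) ^ k) * K"
      using Suc K(1) by (intro mult_right_mono mult_left_mono) auto
    finally show ?case by (simp add: mult_ac)
  qed simp
  show ?thesis
  proof (rule summable_comparison_test')
    show "summable (\<lambda>k. norm (mat 1 :: real^'n^'n) * (inverse (fact k) * (\<bar>t\<bar> * (norm A * K)) ^ k))"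
      by (intro summable_mult summable_exp)
    fix k :: nat
    show "norm ((t ^ k / fact k) *\<^sub>R (((**) A ^^ k) (mat 1)))
      \<le> norm (mat 1 :: real^'n^'n) * (inverse (fact k) * (\<bar>t\<bar> * (norm A * K)) ^ k)"
      using mult_left_mono [OF pow [of k], of "\<bar>t\<bar> ^ k / fact k"]
      by (simp add: power_mult_distrib power_abs field_simps)
  qed
qed

lemma matrix_power_scaleR:
  fixes A :: "real^'n^'n"
  shows "((**) (t *\<^sub>R A) ^^ k) (mat 1) = t ^ k *\<^sub>R (((**) A ^^ k) (mat 1))"
  by (induction k) (simp_all add: mm.scaleR_left mm.scaleR_right mult.commute)

lemma mat_exp_scaleR:
  fixes A :: "real^'n^'n"
  shows "mat_exp (t *\<^sub>R A) = (\<Sum>k. (t ^ k / fact k) *\<^sub>R (((**) A ^^ k) (mat 1)))"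
  by (simp add: mat_exp_def matrix_power_scaleR)

lemma mat_exp_0 [simp]: "mat_exp (0 :: real^'n^'n) = mat 1"
proof -
  have "(\<Sum>k. (1 / fact k) *\<^sub>R (((**) (0 :: real^'n^'n) ^^ k) (mat 1)))
      = (\<Sum>k\<in>{0}. (1 / fact k) *\<^sub>R (((**) (0 :: real^'n^'n) ^^ k) (mat 1)))"
  proof (rule suminf_finite)
    fix k :: nat assume "k \<notin> {0}"
    then show "(1 / fact k) *\<^sub>R (((**) (0 :: real^'n^'n) ^^ k) (mat 1)) = 0"
      by (cases k) (simp_all add: mm.zero_left)
  qed simp
  then show ?thesis
    by (simp add: mat_exp_def)
qed

lemma has_vector_derivative_vec:
  fixes f :: "real \<Rightarrow> 'a::euclidean_space^'n"
  assumes "\<And>i. ((\<lambda>t. f t $ i) has_vector_derivative f' $ i) (at t)"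
  shows "(f has_vector_derivative f') (at t)"
  using assms unfolding has_vector_derivative_def has_derivative_componentwise_within [of f]
  by (auto simp: Basis_vec_def inner_axis intro!: derivative_eq_intros)

text \<open>Each entry of the exponential is a real power series in \<open>t\<close> that converges
  everywhere, so it may be differentiated term by term.\<close>

lemma mat_exp_has_vector_derivative:
  fixes A :: "real^'n^'n"
  shows "((\<lambda>t. mat_exp (t *\<^sub>R A)) has_vector_derivative A ** mat_exp (t *\<^sub>R A)) (at t)"
proof (intro has_vector_derivative_vec)
  fix i j
  define P where "P k = ((**) A ^^ k) (mat 1)" for k
  define c where "c k = P k $ i $ j / fact k" for k
  have bl: "bounded_linear (\<lambda>X :: real^'n^'n. X $ i $ j)"
    by (intro bounded_linear_compose [OF bounded_linear_vec_nth bounded_linear_vec_nth])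
  have entry: "summable (\<lambda>k. c k * s ^ k)" "mat_exp (s *\<^sub>R A) $ i $ j = (\<Sum>k. c k * s ^ k)" for s
    using bounded_linear.summable [OF bl summable_mat_exp [of s A]]
      bounded_linear.suminf [OF bl summable_mat_exp [of s A]]
    by (simp_all add: c_def P_def mat_exp_scaleR mult.commute)
  have "(A ** mat_exp (t *\<^sub>R A)) $ i $ j = (\<Sum>k. (A ** ((t ^ k / fact k) *\<^sub>R P k)) $ i $ j)"
    using bounded_linear.suminf [OF bounded_linear_compose [OF bl mm.bounded_linear_right[of A]]
        summable_mat_exp [of t A]]
    by (simp add: mat_exp_scaleR P_def)
  \<comment> \<open>Since \<open>A ** P k = P (Suc k)\<close> and
    \<open>fact (Suc k) = Suc k * fact k\<close>, the entry of \<open>A ** P k\<close> divided by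
    \<open>fact k\<close> is \<open>Suc k * c (Suc k)\<close>.\<close>
  also have "\<dots> = (\<Sum>k. diffs c k * t ^ k)"
    by (intro suminf_cong) (simp add: diffs_def c_def P_def mm.scaleR_right divide_simps del: of_nat_Suc)
  finally have "(A ** mat_exp (t *\<^sub>R A)) $ i $ j = (\<Sum>k. diffs c k * t ^ k)" .
  moreover have "((\<lambda>s. \<Sum>k. c k * s ^ k) has_field_derivative (\<Sum>k. diffs c k * t ^ k)) (at t)"
    by (intro termdiffs_strong_converges_everywhere entry)
  ultimately show "((\<lambda>s. mat_exp (s *\<^sub>R A) $ i $ j) has_vector_derivative
      (A ** mat_exp (t *\<^sub>R A)) $ i $ j) (at t)"
    by (simp add: entry has_real_derivative_iff_has_vector_derivative)
qed

text \<open>By the product rule \<open>F\<close> has derivative X^T (A^T J + J A) X = 0, so it keeps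
  its value \<open>J\<close> at \<open>t = 0\<close>.\<close>

lemma mat_exp_preserves_form:
  fixes A J :: "real^'n^'n"
  assumes "transpose A ** J + J ** A = 0"
  shows "transpose (mat_exp (t *\<^sub>R A)) ** J ** mat_exp (t *\<^sub>R A) = J"
proof -
  define X where "X t = mat_exp (t *\<^sub>R A)" for t
  define F where "F t = transpose (X t) ** J ** X t" for t
  have bl: "bounded_linear (transpose :: real^'n^'n \<Rightarrow> real^'n^'n)"
    unfolding linear_conv_bounded_linear [symmetric]
    by (auto intro!: linearI simp: transpose_def vec_eq_iff)
  have X: "(X has_vector_derivative A ** X t) (at t)" for t
    unfolding X_def by (rule mat_exp_has_vector_derivative)
  have "(F has_vector_derivative 0) (at t)" for t
  proof -
    have "(F has_vector_derivative
        (transpose (X t) ** J) ** (A ** X t) + (transpose (A ** X t) ** J) ** X t) (at t)"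
      unfolding F_def
      by (intro mm.has_vector_derivative X
          bounded_linear.has_vector_derivative [OF mm.bounded_linear_left]
          bounded_linear.has_vector_derivative [OF bl])
    also have "(transpose (X t) ** J) ** (A ** X t) + (transpose (A ** X t) ** J) ** X t
        = transpose (X t) ** (transpose A ** J + J ** A) ** X t"
      by (simp add: matrix_transpose_mul matrix_mul_assoc mm.add_left mm.add_right add.commute)
    finally show ?thesis
      by (simp add: assms mm.zero_left mm.zero_right)
  qed
  then have "F t = F 0"
    unfolding has_vector_derivative_def
    by (intro has_derivative_zero_unique [of UNIV]) auto
  then show ?thesis
    by (simp add: F_def X_def transpose_mat)
qed

section \<open>Symmetry of second derivatives\<close>

text \<open>Two uses of the mean value theorem: along \<open>u\<close> for the increment of
  \<open>U\<close> in direction \<open>v\<close>, then along \<open>v\<close> for the derivative of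
  \<open>U\<close> in direction \<open>u\<close>. The left-hand side is symmetric in
  \<open>u\<close> and \<open>v\<close>, so exchanging them expresses the same number through the
  other mixed derivative.\<close>

lemma second_difference_eq:
  fixes U :: "'a::real_normed_vector \<Rightarrow> real"
  assumes U: "\<And>x. (U has_derivative U' x) (at x)"
    and H: "\<And>x. ((\<lambda>x. U' x u) has_derivative H x) (at x)"
    and "s > 0"
  obtains \<xi> \<eta> where "0 < \<xi>" "\<xi> < s" "0 < \<eta>" "\<eta> < s"
    "U (x + s *\<^sub>R u + s *\<^sub>R v) - U (x + s *\<^sub>R u) - U (x + s *\<^sub>R v) + U x
      = s\<^sup>2 * H (x + \<xi> *\<^sub>R u + \<eta> *\<^sub>R v) v"
proof -
  have line: "((\<lambda>r. W (a + r *\<^sub>R w)) has_real_derivative W' (a + r *\<^sub>R w) w) (at r)"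
    if W: "\<And>x. (W has_derivative W' x) (at x)" for W :: "'a \<Rightarrow> real" and W' a w r
  proof -
    have "((\<lambda>r. W (a + r *\<^sub>R w)) has_derivative (\<lambda>d. W' (a + r *\<^sub>R w) (d *\<^sub>R w))) (at r)"
      by (rule has_derivative_compose [OF _ W]) (auto intro!: derivative_eq_intros)
    then show ?thesis
      using linear_scale [OF has_derivative_linear [OF W]]
      by (simp add: has_field_derivative_def mult_commute_abs)
  qed
  define g where "g r = U ((x + s *\<^sub>R v) + r *\<^sub>R u) - U (x + r *\<^sub>R u)" for r
  have "(g has_real_derivative U' ((x + s *\<^sub>R v) + r *\<^sub>R u) u - U' (x + r *\<^sub>R u) u) (at r)" for r
    unfolding g_def by (intro derivative_intros line U)
  from MVT2 [OF \<open>s > 0\<close> this] obtain \<xi> where \<xi>: "0 < \<xi>" "\<xi> < s"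
    "g s - g 0 = s * (U' ((x + s *\<^sub>R v) + \<xi> *\<^sub>R u) u - U' (x + \<xi> *\<^sub>R u) u)"
    by auto
  from MVT2 [OF \<open>s > 0\<close> line [OF H, of "x + \<xi> *\<^sub>R u" v]] obtain \<eta> where \<eta>: "0 < \<eta>" "\<eta> < s"
    "U' (x + \<xi> *\<^sub>R u + s *\<^sub>R v) u - U' (x + \<xi> *\<^sub>R u) u = s * H (x + \<xi> *\<^sub>R u + \<eta> *\<^sub>R v) v"
    by auto
  have "U (x + s *\<^sub>R u + s *\<^sub>R v) - U (x + s *\<^sub>R u) - U (x + s *\<^sub>R v) + U x = g s - g 0"
    by (simp add: g_def algebra_simps)
  also have "\<dots> = s\<^sup>2 * H (x + \<xi> *\<^sub>R u + \<eta> *\<^sub>R v) v"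
    using \<xi>(3) \<eta>(3) by (simp add: add_ac power2_eq_square)
  finally show ?thesis
    using that \<xi> \<eta> by blast
qed

text \<open>Schwarz's theorem. The two expressions for the second difference make the mixed
  derivatives agree at points arbitrarily close to \<open>x\<close>, though not at the same point;
  continuity carries the equality to \<open>x\<close>.\<close>

lemma mixed_second_derivatives_eq:
  fixes U :: "'a::real_normed_vector \<Rightarrow> real"
  assumes U: "\<And>x. (U has_derivative U' x) (at x)"
    and Hu: "\<And>x. ((\<lambda>x. U' x u) has_derivative Hu x) (at x)"
    and Hv: "\<And>x. ((\<lambda>x. U' x v) has_derivative Hv x) (at x)"
    and cu: "isCont (\<lambda>x. Hu x v) x" and cv: "isCont (\<lambda>x. Hv x u) x"
  shows "Hu x v = Hv x u"
proof (rule ccontr)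
  assume neq: "Hu x v \<noteq> Hv x u"
  \<comment> \<open>With half the gap as tolerance, a single number cannot be within
    \<open>e\<close> of both values.\<close>
  define e where "e = \<bar>Hu x v - Hv x u\<bar> / 2"
  have "e > 0" using neq by (simp add: e_def)
  obtain d1 where d1: "d1 > 0" "\<And>p. dist p x < d1 \<Longrightarrow> dist (Hu p v) (Hu x v) < e"
    using cu \<open>e > 0\<close> unfolding continuous_at_eps_delta by blast
  obtain d2 where d2: "d2 > 0" "\<And>p. dist p x < d2 \<Longrightarrow> dist (Hv p u) (Hv x u) < e"
    using cv \<open>e > 0\<close> unfolding continuous_at_eps_delta by blast
  \<comment> \<open>Small enough that the intermediate points of both expansions lie in both balls;
    the summand 1 keeps the denominator positive and the bound strict.\<close>
  define s where "s = min d1 d2 / (norm u + norm v + 1)"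
  have pos: "norm u + norm v + 1 > 0"
    by (simp add: add_nonneg_pos)
  have s: "s > 0" using d1 d2 pos by (simp add: s_def)
  \<comment> \<open>Stated for \<open>w\<close> and \<open>z\<close> because it serves both orders
    of the pair \<open>u\<close>, \<open>v\<close>.\<close>
  have near: "dist (x + a *\<^sub>R w + b *\<^sub>R z) x < min d1 d2"
    if "0 < a" "a < s" "0 < b" "b < s" "norm w + norm z = norm u + norm v" for a b w z
  proof -
    have "dist (x + a *\<^sub>R w + b *\<^sub>R z) x \<le> norm (a *\<^sub>R w) + norm (b *\<^sub>R z)"
      by (simp add: dist_norm add.assoc del: norm_scaleR) (rule norm_triangle_ineq)
    also have "\<dots> \<le> s * norm w + s * norm z"
      using that by (intro add_mono) (auto intro!: mult_right_mono)
    also have "\<dots> = s * (norm u + norm v)"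
      using that(5) by (simp add: distrib_left [symmetric])
    also have "\<dots> < s * (norm u + norm v + 1)" using s by simp
    also have "\<dots> = min d1 d2" using pos by (simp add: s_def)
    finally show ?thesis .
  qed
  obtain a b where ab: "0 < a" "a < s" "0 < b" "b < s"
    "U (x + s *\<^sub>R u + s *\<^sub>R v) - U (x + s *\<^sub>R u) - U (x + s *\<^sub>R v) + U x
      = s\<^sup>2 * Hu (x + a *\<^sub>R u + b *\<^sub>R v) v"
    by (rule second_difference_eq [OF U Hu s])
  obtain a' b' where ab': "0 < a'" "a' < s" "0 < b'" "b' < s"
    "U (x + s *\<^sub>R v + s *\<^sub>R u) - U (x + s *\<^sub>R v) - U (x + s *\<^sub>R u) + U x
      = s\<^sup>2 * Hv (x + a' *\<^sub>R v + b' *\<^sub>R u) u"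
    by (rule second_difference_eq [OF U Hv s])
  have "s\<^sup>2 * Hu (x + a *\<^sub>R u + b *\<^sub>R v) v = s\<^sup>2 * Hv (x + a' *\<^sub>R v + b' *\<^sub>R u) u"
    unfolding ab(5) [symmetric] ab'(5) [symmetric] by (simp add: add_ac)
  then have "Hu (x + a *\<^sub>R u + b *\<^sub>R v) v = Hv (x + a' *\<^sub>R v + b' *\<^sub>R u) u"
    using s by simp
  moreover have "dist (Hu (x + a *\<^sub>R u + b *\<^sub>R v) v) (Hu x v) < e"
    using near [OF ab(1-4)] d1 by simp
  moreover have "dist (Hv (x + a' *\<^sub>R v + b' *\<^sub>R u) u) (Hv x u) < e"
    using near [OF ab'(1-4)] d2 by simp
  ultimately show False
    unfolding e_def dist_real_def by (smt (verit, best) field_sum_of_halves)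
qed

text \<open>The Jacobian of the gradient is the Hessian. The functions
  \<open>u \<bullet> gradU x\<close> are the directional derivatives of \<open>U\<close>, so
  \<open>Ck 2 U\<close> makes them continuously differentiable, and Schwarz's theorem applies to
  them.\<close>

lemma gradient_jacobian_symmetric:
  fixes U :: "real^'n \<Rightarrow> real"
  assumes "Ck 2 U" and grad: "\<And>y. GDERIV U y :> gradU y"
  shows "(gradU has_derivative (*v) (jacobian gradU (at y))) (at y)"
    and "transpose (jacobian gradU (at y)) = jacobian gradU (at y)"
proof -
  have U: "(U has_derivative (\<lambda>v. v \<bullet> gradU x)) (at x)" for x
    using grad by (simp add: gderiv_def)
  have fd: "frechet_derivative U (at x) = (\<lambda>v. v \<bullet> gradU x)" for x
    using frechet_derivative_at [OF U] by simp
  define H where "H u x = frechet_derivative (\<lambda>x. u \<bullet> gradU x) (at x)" for u x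
  have H: "((\<lambda>x. u \<bullet> gradU x) has_derivative H u x) (at x)" for u x
    using \<open>Ck 2 U\<close> unfolding H_def frechet_derivative_works [symmetric]
    by (simp add: numeral_2_eq_2 fd)
  have cont: "isCont (\<lambda>x. H u x v) x" for u v x
    using \<open>Ck 2 U\<close> unfolding H_def
    by (simp add: numeral_2_eq_2 fd continuous_on_eq_continuous_at)
  have "gradU differentiable (at y)" for y
    using H differentiable_componentwise_within [of gradU y UNIV]
    by (auto simp: inner_commute differentiable_def)
  then show jac: "(gradU has_derivative (*v) (jacobian gradU (at y))) (at y)" for y
    using jacobian_works by blast
  \<comment> \<open>Identifies the second derivative in directions \<open>u\<close> and
    \<open>v\<close> with the Hessian form, whose values at unit vectors are the matrix
    entries.\<close>
  have "H u y = (\<lambda>v. u \<bullet> (jacobian gradU (at y) *v v))" for u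
    by (rule has_derivative_unique [OF H]) (auto intro!: derivative_eq_intros jac)
  moreover have "H u y v = H v y u" for u v
    by (rule mixed_second_derivatives_eq [OF U H H cont cont])
  ultimately have "u \<bullet> (jacobian gradU (at y) *v v) = v \<bullet> (jacobian gradU (at y) *v u)" for u v
    by metis
  from this [of "axis i 1" "axis j 1" for i j]
  show "transpose (jacobian gradU (at y)) = jacobian gradU (at y)"
    by (simp add: vec_eq_iff transpose_def inner_axis' matrix_vector_mul_component inner_axis)
qed

section \<open>Algebra of the matrix J\<close>

lemma Jmat_Jmat: "(Jmat :: real^('d::finite + 'd)^('d + 'd)) ** Jmat = - mat 1"
proof -
  have *: "sum g (UNIV :: ('d + 'd) set) = (\<Sum>a\<in>UNIV. g (Inl a)) + (\<Sum>b\<in>UNIV. g (Inr b))"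
    for g :: "'d + 'd \<Rightarrow> real"
    by (subst UNIV_Plus_UNIV [symmetric], subst sum.Plus) (simp_all add: o_def)
  have "(Jmat ** Jmat) $ i $ j = (- mat 1 :: real^('d + 'd)^('d + 'd)) $ i $ j" for i j :: "'d + 'd"
    by (cases i; cases j)
      (simp_all add: * matrix_matrix_mult_def Jmat_def mat_def if_distrib if_distribR
        cong: if_cong)
  then show ?thesis
    by (simp add: vec_eq_iff)
qed

lemma transpose_Jmat: "transpose Jmat = (- Jmat :: real^('d::finite + 'd)^('d + 'd))"
proof -
  have "transpose Jmat $ i $ j = (- Jmat :: real^('d + 'd)^('d + 'd)) $ i $ j" for i j :: "'d + 'd"
    by (cases i; cases j) (auto simp: transpose_def Jmat_def)
  then show ?thesis
    by (simp add: vec_eq_iff)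
qed

lemma matrix_inv_Jmat: "matrix_inv Jmat = (- Jmat :: real^('d::finite + 'd)^('d + 'd))"
proof -
  have "invertible (Jmat :: real^('d + 'd)^('d + 'd))"
    unfolding invertible_def
    by (intro exI [of _ "- Jmat"]) (simp add: mm.minus_left mm.minus_right Jmat_Jmat)
  then have inv: "Jmat ** matrix_inv Jmat = (mat 1 :: real^('d + 'd)^('d + 'd))"
    unfolding matrix_inv_def invertible_def by (rule someI2_ex) blast
  \<comment> \<open>\<open>matrix_inv\<close> is a choice of some inverse; inserting
    \<open>mat 1 = - (Jmat ** Jmat)\<close> and using \<open>inv\<close> determines which matrix it
    is.\<close>
  have "matrix_inv Jmat = - (Jmat ** Jmat) ** (matrix_inv Jmat :: real^('d + 'd)^('d + 'd))"
    by (simp add: Jmat_Jmat)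
  also have "\<dots> = - Jmat"
    by (simp add: mm.minus_left matrix_mul_assoc [symmetric] inv)
  finally show ?thesis .
qed


section \<open>Order one\<close>

lemma sverk_stage_0:
  assumes "sverk_stage M f G \<Psi>"
  shows "\<Psi> 0 y = y"
proof -
  have "(0, y) \<in> G"
    using assms by (simp add: sverk_stage_def)
  then have "\<Psi> 0 y = mat_exp (- (0 *\<^sub>R M)) *v y + (0 / 2) *\<^sub>R f (\<Psi> 0 y)"
    using assms unfolding sverk_stage_def by blast
  then show ?thesis
    by simp
qed

text \<open>The stage is only known to be continuous in \<open>h\<close>, so no product rule is
  applied to \<open>h *\<^sub>R f (\<Psi> h y)\<close>. This term vanishes at 0 and its difference
  quotient is \<open>f (\<Psi> h y)\<close>, which tends to
  \<open>f (\<Psi> 0 y) = f y\<close>.\<close>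

lemma sverk_step_has_vector_derivative_0:
  fixes M :: "real^'n^'n"
  assumes st: "sverk_stage M f G \<Psi>" and f: "isCont f y"
  shows "((\<lambda>h. sverk_step M f \<Psi> h y) has_vector_derivative f y - M *v y) (at 0)"
proof -
  have G: "open G" "(0, y) \<in> G" and \<Psi>: "continuous_on G (\<lambda>(h, y). \<Psi> h y)"
    using st by (auto simp: sverk_stage_def)
  have "isCont (\<lambda>h::real. (h, y)) 0"
    by (intro continuous_intros)
  moreover have "isCont (\<lambda>(h, y). \<Psi> h y) (0, y)"
    using G \<Psi> by (simp add: continuous_on_eq_continuous_at)
  ultimately have "isCont (\<lambda>h. \<Psi> h y) 0"
    using isCont_o2 [of 0 "\<lambda>h. (h, y)" "\<lambda>(h, y). \<Psi> h y"] by simp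
  then have "isCont (\<lambda>h. f (\<Psi> h y)) 0"
    by (rule isCont_o2) (simp add: sverk_stage_0 [OF st] f)
  then have "((\<lambda>h. f (\<Psi> h y)) \<longlongrightarrow> f y) (at 0)"
    by (simp add: isCont_def sverk_stage_0 [OF st])
  then have "((\<lambda>h. norm (f (\<Psi> h y) - f y)) \<longlongrightarrow> 0) (at 0)"
    by (simp add: tendsto_norm_zero_iff LIM_zero_iff)
  moreover have "norm (h *\<^sub>R f (\<Psi> h y) - h *\<^sub>R f y) / norm h = norm (f (\<Psi> h y) - f y)"
    if "h \<noteq> 0" for h
    using that by (simp flip: scaleR_diff_right)
  ultimately have "((\<lambda>h. norm (h *\<^sub>R f (\<Psi> h y) - h *\<^sub>R f y) / norm h) \<longlongrightarrow> 0) (at 0)"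
    by (simp cong: LIM_cong)
  then have "((\<lambda>h. h *\<^sub>R f (\<Psi> h y)) has_vector_derivative f y) (at 0)"
    by (simp add: has_vector_derivative_def has_derivative_at bounded_linear_scaleR_left)
  moreover have "((\<lambda>h. mat_exp (h *\<^sub>R (- M)) *v y) has_vector_derivative (- M) *v y) (at 0)"
    using bounded_linear.has_vector_derivative [OF mv.bounded_linear_left
        mat_exp_has_vector_derivative [of "- M" 0], of y]
    by simp
  ultimately show ?thesis
    unfolding sverk_step_def
    by (auto dest: has_vector_derivative_add simp: mv.minus_left add.commute)
qed

lemma has_taylor_coeffs_1:
  assumes "(g has_vector_derivative d) (at 0)"
  shows "has_taylor_coeffs 1 g (\<lambda>j. if j = 0 then g 0 else d)"
  unfolding has_taylor_coeffs_def
  \<comment> \<open>For order 1 the first derivative enters only through its value at 0, so a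
    constant function can stand for it.\<close>
  by (rule exI [of _ "\<lambda>j. if j = 0 then g else (\<lambda>_. d)"]) (use assms in \<open>auto simp: le_Suc_eq\<close>)

lemma sverk_has_order_1:
  fixes M :: "real^'n^'n"
  assumes f: "continuous_on UNIV f" and st: "sverk_stage M f G \<Psi>"
  shows "has_order 1 M f (sverk_step M f \<Psi>)"
  unfolding has_order_def
proof (intro allI impI)
  fix t0 y0 y
  assume "solves_ivp M f t0 y0 y"
  then have y0: "y t0 = y0" and "\<exists>y'. (y has_vector_derivative y') (at t0) \<and> y' + M *v y t0 = f (y t0)"
    by (auto simp: solves_ivp_def dest: eventually_nhds_x_imp_x)
  \<comment> \<open>The differential equation at \<open>t0\<close> itself, solved for the
    derivative; the form \<open>t0 + 0\<close> fits the chain rule for the shift by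
    \<open>t0\<close>.\<close>
  then have "(y has_vector_derivative f y0 - M *v y0) (at (t0 + 0))"
    by (metis add_diff_cancel_right' add_0_right)
  then have exact: "((\<lambda>h. y (t0 + h)) has_vector_derivative f y0 - M *v y0) (at 0)"
    unfolding has_vector_derivative_def
    by (intro has_derivative_compose [where g = y and f = "\<lambda>h. t0 + h" and f' = "\<lambda>h. h"])
      (auto intro!: derivative_eq_intros)
  have num: "((\<lambda>h. sverk_step M f \<Psi> h y0) has_vector_derivative f y0 - M *v y0) (at 0)"
    using f by (intro sverk_step_has_vector_derivative_0 [OF st])
      (simp add: continuous_on_eq_continuous_at)
  have "sverk_step M f \<Psi> 0 y0 = y0"
    by (simp add: sverk_step_def)
  then show "\<exists>c. has_taylor_coeffs 1 (\<lambda>h. sverk_step M f \<Psi> h y0) c \<and>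
      has_taylor_coeffs 1 (\<lambda>h. y (t0 + h)) c"
    using has_taylor_coeffs_1 [OF num] has_taylor_coeffs_1 [OF exact] y0 by (metis add_0_right)
qed

section \<open>Symplecticity\<close>

lemma jacobian_eqI:
  fixes A :: "real^'n^'m"
  assumes "(f has_derivative (*v) A) (at x)"
  shows "jacobian f (at x) = A"
  by (simp add: jacobian_def frechet_derivative_at [OF assms, symmetric])

text \<open>The assumptions on \<open>M\<close> and \<open>F\<close> say that both are
  infinitesimally symplectic for the form \<open>J\<close>: the first makes the exponential preserve
  the form, the second cancels the cross terms.\<close>

lemma sverk_step_symplectic:
  fixes M J :: "real^'n^'n"
  assumes st: "sverk_stage M f G \<Psi>" and hy: "(h, y) \<in> G"
    and M: "transpose M ** J + J ** M = 0"
    and f: "(f has_derivative (*v) F) (at (\<Psi> h y))"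
    and F: "transpose F ** J + J ** F = 0"
  obtains N where "(sverk_step M f \<Psi> h has_derivative (*v) N) (at y)"
    and "transpose N ** J ** N = J"
proof -
  define S where "S = mat_exp (- (h *\<^sub>R M))"
  define P where "P = jacobian (\<Psi> h) (at y)"
  define B where "B = (h / 2) *\<^sub>R (F ** P)"
  have G: "open G"
    and eq: "\<And>y. (h, y) \<in> G \<Longrightarrow> \<Psi> h y = S *v y + (h / 2) *\<^sub>R f (\<Psi> h y)"
    and "\<Psi> h differentiable (at y)"
    using st hy unfolding sverk_stage_def S_def by blast+
  then have P: "(\<Psi> h has_derivative (*v) P) (at y)"
    unfolding P_def using jacobian_works by blast
  have fP: "((\<lambda>y. f (\<Psi> h y)) has_derivative (\<lambda>v. F *v (P *v v))) (at y)"
    by (rule has_derivative_compose [OF P f])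
  have S: "((*v) S has_derivative (*v) S) (at y)"
    by (intro bounded_linear_imp_has_derivative mv.bounded_linear_right)
  have "((\<lambda>y. S *v y + (h / 2) *\<^sub>R f (\<Psi> h y)) has_derivative
      (\<lambda>v. S *v v + (h / 2) *\<^sub>R (F *v (P *v v)))) (at y)"
    by (intro has_derivative_add S has_derivative_scaleR_right fP)
  \<comment> \<open>The stage equation holds on this slice of \<open>G\<close>, a neighbourhood of
    \<open>y\<close>, so both of its sides have the same derivative at \<open>y\<close>.\<close>
  moreover have "open {z. (h, z) \<in> G}"
    using open_vimage [OF G, of "Pair h"] by (simp add: vimage_def continuous_on_Pair)
  ultimately have "(\<Psi> h has_derivative (\<lambda>v. S *v v + (h / 2) *\<^sub>R (F *v (P *v v)))) (at y)"
    by (rule has_derivative_transform_within_open) (use hy eq in auto)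
  from has_derivative_unique [OF P this]
  have "P *v v = (S + B) *v v" for v
    by (simp add: B_def mv.add_left mv.scaleR_left matrix_vector_mul_assoc fun_eq_iff)
  then have PSB: "P = S + B"
    by (simp add: matrix_eq)
  have "(sverk_step M f \<Psi> h has_derivative (\<lambda>v. S *v v + h *\<^sub>R (F *v (P *v v)))) (at y)"
    unfolding sverk_step_def S_def [symmetric]
    by (intro has_derivative_add S has_derivative_scaleR_right fP)
  \<comment> \<open>The update uses \<open>h\<close> where the stage uses \<open>h / 2\<close>, so
    the Jacobian is S + 2B = P + B.\<close>
  also have "(\<lambda>v. S *v v + h *\<^sub>R (F *v (P *v v))) = (*v) (P + B)"
  proof
    fix v
    have "(P + B) *v v = S *v v + (B *v v + B *v v)"
      by (simp only: PSB mv.add_left add.assoc)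
    also have "B *v v + B *v v = (h / 2 + h / 2) *\<^sub>R (F *v (P *v v))"
      by (simp only: B_def mv.scaleR_left matrix_vector_mul_assoc scaleR_add_left)
    finally show "S *v v + h *\<^sub>R (F *v (P *v v)) = (P + B) *v v"
      by simp
  qed
  finally have "(sverk_step M f \<Psi> h has_derivative (*v) (P + B)) (at y)" .
  moreover have "transpose (P + B) ** J ** (P + B) = J"
  proof -
    have "transpose B ** J ** P + transpose P ** J ** B
        = (h / 2) *\<^sub>R (transpose P ** (transpose F ** J + J ** F) ** P)"
      by (simp add: B_def transpose_scalar matrix_transpose_mul matrix_mul_assoc mm.add_left
          mm.add_right mm.scaleR_left mm.scaleR_right scaleR_add_right)
    then have cross: "transpose B ** J ** P + transpose P ** J ** B = 0"
      by (simp add: F mm.zero_left mm.zero_right)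
    have Sm: "S = P - B" using PSB by simp
    have "transpose S ** J ** S = J"
      using mat_exp_preserves_form [OF M, of "- h"] by (simp add: S_def)
    \<comment> \<open>Expanding the form at P - B leaves only the diagonal terms; the expansion at P
      + B below has the same diagonal terms and the opposite sign on the vanishing cross
      terms.\<close>
    then have "transpose P ** J ** P + transpose B ** J ** B = J"
      using cross by (simp add: Sm transpose_diff mm.diff_left mm.diff_right algebra_simps)
    moreover have "transpose (P + B) ** J ** (P + B) = (transpose P ** J ** P + transpose B ** J ** B)
        + (transpose B ** J ** P + transpose P ** J ** B)"
      by (simp add: transpose_add mm.add_left mm.add_right add_ac)
    ultimately show ?thesis
      using cross by simp
  qed
  ultimately show ?thesis by (rule that)
qed

text \<open>By the chain rule the Jacobian of the next iterate is \<open>N ** A\<close>, and the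
  factor \<open>N\<close> drops out of the form because it preserves \<open>J\<close>.\<close>

lemma symplectic_method_of_step:
  assumes step: "\<And>h y. (h, y) \<in> G \<Longrightarrow>
    \<exists>N. (\<Phi> h has_derivative (*v) N) (at y) \<and> transpose N ** J ** N = J"
  shows "symplectic_method J G \<Phi>"
  unfolding symplectic_method_def
proof (intro allI impI)
  fix h y0 n
  assume G: "\<forall>k\<le>n. (h, (\<Phi> h ^^ k) y0) \<in> G"
  \<comment> \<open>Iterate \<open>k\<close> needs the points 0 to \<open>k - 1\<close> in the
    domain; point \<open>n\<close> is left for the final step to iterate
    \<open>Suc n\<close>.\<close>
  have "\<exists>A. ((\<Phi> h ^^ k) has_derivative (*v) A) (at y0)" if "k \<le> n" for k
    using that
  proof (induction k)
    case 0
    then show ?case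
      by (intro exI [of _ "mat 1"]) (simp add: id_def matrix_vector_mul_lid [abs_def])
  next
    case (Suc k)
    then obtain A N where A: "((\<Phi> h ^^ k) has_derivative (*v) A) (at y0)"
      and N: "(\<Phi> h has_derivative (*v) N) (at ((\<Phi> h ^^ k) y0))"
      using step [of h "(\<Phi> h ^^ k) y0"] G by auto
    show ?case
      using diff_chain_at [OF A N]
      by (intro exI [of _ "N ** A"]) (simp add: o_def matrix_vector_mul_assoc)
  qed
  then obtain A where A: "((\<Phi> h ^^ n) has_derivative (*v) A) (at y0)"
    by blast
  obtain N where N: "(\<Phi> h has_derivative (*v) N) (at ((\<Phi> h ^^ n) y0))"
    and NJN: "transpose N ** J ** N = J"
    using step [of h "(\<Phi> h ^^ n) y0"] G by auto
  have NA: "((\<Phi> h ^^ Suc n) has_derivative (*v) (N ** A)) (at y0)"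
    using diff_chain_at [OF A N] by (simp add: o_def matrix_vector_mul_assoc)
  have "transpose (N ** A) ** J ** (N ** A) = transpose A ** (transpose N ** J ** N) ** A"
    by (simp add: matrix_transpose_mul matrix_mul_assoc)
  also have "\<dots> = transpose A ** J ** A"
    by (simp only: NJN)
  finally show "(\<Phi> h ^^ n) differentiable (at y0) \<and> (\<Phi> h ^^ Suc n) differentiable (at y0) \<and>
      transpose (jacobian (\<Phi> h ^^ Suc n) (at y0)) ** J ** jacobian (\<Phi> h ^^ Suc n) (at y0) =
      transpose (jacobian (\<Phi> h ^^ n) (at y0)) ** J ** jacobian (\<Phi> h ^^ n) (at y0)"
    unfolding jacobian_eqI [OF A] jacobian_eqI [OF NA]
    using A NA differentiable_def by blast
qed

text \<open>As J is skew with inverse -J, the transpose of its inverse is J; hence the first summand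
  is H J J = -H and the second is H. This serves both for \<open>Q\<close> and for the Hessian of
  \<open>U\<close>.\<close>

lemma Jmat_symmetric_Hamiltonian:
  fixes H :: "real^('d::finite + 'd)^('d + 'd)"
  assumes "transpose H = H"
  shows "transpose (matrix_inv Jmat ** H) ** Jmat + Jmat ** (matrix_inv Jmat ** H) = 0"
proof -
  have "transpose (matrix_inv Jmat ** H) ** Jmat = H ** (Jmat ** Jmat)"
    by (simp add: matrix_inv_Jmat mm.minus_left matrix_transpose_mul assms transpose_minus
        transpose_Jmat mm.minus_right matrix_mul_assoc)
  moreover have "Jmat ** (matrix_inv Jmat ** H) = - (Jmat ** Jmat) ** H"
    by (simp add: matrix_inv_Jmat mm.minus_left mm.minus_right matrix_mul_assoc)
  ultimately show ?thesis
    by (simp add: Jmat_Jmat mm.minus_right)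
qed

lemma sverk_symplectic:
  fixes M :: "real^('d::finite + 'd)^('d + 'd)"
  assumes Q: "transpose Q = Q" and M: "M = - (matrix_inv Jmat ** Q)"
    and U: "Ck 2 U" "\<And>y. GDERIV U y :> gradU y"
    and f: "f = (\<lambda>y. matrix_inv Jmat *v gradU y)"
    and st: "sverk_stage M f G \<Psi>"
  shows "symplectic_method Jmat G (sverk_step M f \<Psi>)"
proof (rule symplectic_method_of_step)
  fix h y
  assume hy: "(h, y) \<in> G"
  define H where "H = jacobian gradU (at (\<Psi> h y))"
  \<comment> \<open>The condition is linear in the matrix, so the minus sign in \<open>M\<close> is
    harmless.\<close>
  have "transpose M ** Jmat + Jmat ** M
      = - (transpose (matrix_inv Jmat ** Q) ** Jmat + Jmat ** (matrix_inv Jmat ** Q))"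
    by (simp add: M transpose_minus mm.minus_left mm.minus_right)
  then have M': "transpose M ** Jmat + Jmat ** M = 0"
    by (simp add: Jmat_symmetric_Hamiltonian [OF Q])
  have "(f has_derivative (\<lambda>v. matrix_inv Jmat *v (H *v v))) (at (\<Psi> h y))"
    unfolding f H_def
    by (rule bounded_linear.has_derivative [OF mv.bounded_linear_right
          gradient_jacobian_symmetric(1) [OF U]])
  then have f': "(f has_derivative (*v) (matrix_inv Jmat ** H)) (at (\<Psi> h y))"
    by (simp add: matrix_vector_mul_assoc)
  have "transpose H = H"
    unfolding H_def by (rule gradient_jacobian_symmetric(2) [OF U])
  from sverk_step_symplectic [OF st hy M' f' Jmat_symmetric_Hamiltonian [OF this]]
  show "\<exists>N. (sverk_step M f \<Psi> h has_derivative (*v) N) (at y) \<and>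
      transpose N ** Jmat ** N = Jmat"
    by blast
qed

theorem mainTheorem2:
  shows "(\<forall>(M :: real^'m^'m) f G \<Psi>.
            Ck 1 f \<longrightarrow> sverk_stage M f G \<Psi> \<longrightarrow> has_order 1 M f (sverk_step M f \<Psi>)) \<and>
         (\<forall>(M :: real^('d::finite + 'd)^('d + 'd)) Q f U gradU G \<Psi>.
            transpose Q = Q \<longrightarrow>
            M = - (matrix_inv Jmat ** Q) \<longrightarrow>
            Ck 2 U \<longrightarrow>
            (\<forall>y. GDERIV U y :> gradU y) \<longrightarrow>
            f = (\<lambda>y. matrix_inv Jmat *v gradU y) \<longrightarrow>
            sverk_stage M f G \<Psi> \<longrightarrow>
            symplectic_method Jmat G (sverk_step M f \<Psi>))"
proof (intro conjI allI impI)
  fix M :: "real^'m^'m" and f G \<Psi>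
  assume "Ck 1 f" "sverk_stage M f G \<Psi>"
  moreover from \<open>Ck 1 f\<close> have "continuous_on UNIV f"
    by (simp add: continuous_on_eq_continuous_at differentiable_imp_continuous_within)
  ultimately show "has_order 1 M f (sverk_step M f \<Psi>)"
    by (intro sverk_has_order_1)
qed (blast intro: sverk_symplectic)

end
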